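(* Let $W$ be an order smooth subspace of an order smooth $\infty$-normed space $(V,V^+)$. Then every positive bounded linear functional on $W$ has a positive norm preserving extension on $V$; that is, for every bounded linear $f:W\to\mathbb{R}$ with $f\ge 0$ on $W\cap V^+$ there is a bounded linear $F:V\to\mathbb{R}$ with $F\ge0$ on $V^+$, $F|_W=f$ and $\|F\|=\|f\|$.
   Context: Let $(V,V^+)$ be a real ordered vector space whose positive cone $V^+$ is proper ($V^+\cap -V^+=\{0\}$) and generating ($V=V^+-V^+$), with a norm in which $V^+$ is closed. $V$ is an order smooth $\infty$-normed space if: $(O.\infty.1)$ $u\le v\le w$ implies $\|v\|\le\max(\|u\|,\|w\|)$; $(O.\infty.2)$ for $v\in V$ and $\epsilon>0$ there are $v_1,v_2\in V^+$ with $v=v_1-v_2$ and $\max(\|v_1\|,\|v_2\|)\le\|v\|+\epsilon$. An order smooth subspace $W$ of an order smooth $\infty$-normed space $V$ is a linear subspace which is itself an order smooth $\infty$-normed space when the order (with $W^+=W\cap V^+$) and the norm of $V$ are restricted to $W$. *)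

theory Defs
  imports "HOL-Analysis.Analysis"
begin

text \<open>
  The ordered vector space \<open>V\<close> is a type of class \<open>ordered_real_vector\<close>; its positive cone is
  \<open>pos_cone UNIV = {v. 0 \<le> v}\<close>, which is proper since the order is antisymmetric. Subspaces of \<open>V\<close>
  are sets carrying the restricted order and norm.
\<close>

definition pos_cone :: "'a::ordered_real_vector set \<Rightarrow> 'a set" where
  "pos_cone W = {v \<in> W. 0 \<le> v}"

text \<open>The space \<open>V\<close> itself is the case \<open>W = UNIV\<close>.\<close>

definition order_smooth_inf_on ::
  "'a::{real_normed_vector, ordered_real_vector} set \<Rightarrow> bool" where
  "order_smooth_inf_on W \<longleftrightarrow>
     subspace W \<and>
     (\<forall>w\<in>W. \<exists>w1\<in>pos_cone W. \<exists>w2\<in>pos_cone W. w = w1 - w2) \<and>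
     closedin (top_of_set W) (pos_cone W) \<and>
     (\<forall>u\<in>W. \<forall>v\<in>W. \<forall>w\<in>W. u \<le> v \<and> v \<le> w \<longrightarrow> norm v \<le> max (norm u) (norm w)) \<and>
     (\<forall>v\<in>W. \<forall>\<epsilon>>0. \<exists>v1\<in>pos_cone W. \<exists>v2\<in>pos_cone W.
        v = v1 - v2 \<and> max (norm v1) (norm v2) \<le> norm v + \<epsilon>)"

text \<open>
  Functionals on a subspace are total functions of which only the values on \<open>W\<close> matter. On
  \<open>W = UNIV\<close> the next two notions are \<open>bounded_linear\<close> and \<open>onorm\<close>; as for \<open>onorm\<close>, the
  quotient at \<open>0\<close> is \<open>0\<close>, so the supremum is over a nonempty set even if \<open>W = {0}\<close>.
\<close>

definition bounded_linear_on ::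
  "'a::real_normed_vector set \<Rightarrow> ('a \<Rightarrow> 'b::real_normed_vector) \<Rightarrow> bool" where
  "bounded_linear_on W f \<longleftrightarrow>
     (\<forall>x\<in>W. \<forall>y\<in>W. f (x + y) = f x + f y) \<and>
     (\<forall>c. \<forall>x\<in>W. f (c *\<^sub>R x) = c *\<^sub>R f x) \<and>
     (\<exists>K. \<forall>x\<in>W. norm (f x) \<le> norm x * K)"

definition onorm_on ::
  "'a::real_normed_vector set \<Rightarrow> ('a \<Rightarrow> 'b::real_normed_vector) \<Rightarrow> real" where
  "onorm_on W f = (SUP x\<in>W. norm (f x) / norm x)"

lemma bounded_linear_on_UNIV: "bounded_linear_on UNIV f \<longleftrightarrow> bounded_linear f"
  by (simp add: bounded_linear_on_def bounded_linear_def bounded_linear_axioms_def linear_iff)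

lemma onorm_on_UNIV: "onorm_on UNIV f = onorm f"
  by (simp add: onorm_on_def onorm_def)

end

theory Submission
  imports Defs
begin

text \<open>
  Let \<open>K = onorm_on W f\<close> and let \<open>p v\<close> be the infimum of \<open>K * norm u\<close> over all positive \<open>u\<close> above
  \<open>v\<close>; this is sublinear. Linear functionals dominated by \<open>p\<close> are positive and have norm at most
  \<open>K\<close>, so Hahn--Banach reduces the claim to \<open>f \<le> p\<close> on \<open>W\<close>: if \<open>w \<le> u\<close>, choose a positive \<open>w\<^sub>0\<close> of
  norm at most \<open>1\<close> at which \<open>f\<close> almost attains its norm. For \<open>t\<close> large compared with \<open>norm w\<close>,
  the vector \<open>w + t w\<^sub>0\<close> lies between a vector of norm at most \<open>t\<close> and \<open>u + t w\<^sub>0\<close>, hence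
  \<open>f w + t f w\<^sub>0 \<le> K (norm u + t)\<close>; now let \<open>f w\<^sub>0\<close> tend to \<open>K\<close> with \<open>t\<close> fixed.
\<close>

section \<open>Sublinear functionals and the Hahn--Banach theorem\<close>

definition sublinear :: "('a::real_vector \<Rightarrow> real) \<Rightarrow> bool" where
  "sublinear p \<longleftrightarrow> (\<forall>x y. p (x + y) \<le> p x + p y) \<and> (\<forall>c\<ge>0. \<forall>x. p (c *\<^sub>R x) = c * p x)"

lemma sublinear_add: "sublinear p \<Longrightarrow> p (x + y) \<le> p x + p y"
  and sublinear_scaleR: "sublinear p \<Longrightarrow> 0 \<le> c \<Longrightarrow> p (c *\<^sub>R x) = c * p x"
  by (auto simp: sublinear_def)

lemma sublinear_zero: "sublinear p \<Longrightarrow> p 0 = 0"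
  using sublinear_scaleR[of p 0 0] by simp

lemma sublinear_minus: "sublinear p \<Longrightarrow> - p (- x) \<le> p x"
  using sublinear_add[of p x "- x"] sublinear_zero[of p] by simp

text \<open>Applying the scaling inequality to \<open>inverse c\<close> at
  \<open>c *\<^sub>R x\<close> gives the reverse one. At \<open>c = 0\<close>, subadditivity yields
  \<open>0 \<le> p 0\<close>, and \<open>c = 1/2\<close> yields
  \<open>p 0 \<le> p 0 / 2\<close>.\<close>

lemma sublinearI:
  fixes p :: "'a::real_vector \<Rightarrow> real"
  assumes add: "\<And>x y. p (x + y) \<le> p x + p y"
    and scale: "\<And>c x. 0 < c \<Longrightarrow> p (c *\<^sub>R x) \<le> c * p x"
  shows "sublinear p"
  unfolding sublinear_def
proof (intro conjI allI impI)
  fix c :: real and x :: 'a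
  assume c: "0 \<le> c"
  show "p (c *\<^sub>R x) = c * p x"
  proof (cases "c = 0")
    case True
    have "p 0 \<ge> 0" using add[of 0 0] by simp
    moreover have "p 0 \<le> 0" using scale[of "1/2" 0] by simp
    ultimately show ?thesis using True by simp
  next
    case False
    with c have c: "0 < c" by simp
    have "p x \<le> inverse c * p (c *\<^sub>R x)" using scale[of "inverse c" "c *\<^sub>R x"] c by simp
    then have "c * p x \<le> p (c *\<^sub>R x)" using c by (simp add: field_simps)
    with scale[OF c, of x] show ?thesis by simp
  qed
qed (rule add)

text \<open>A pair in the convex cone \<open>S\<close> encodes the constraint
  \<open>q (- w) \<le> a\<close>. The infimal convolution
  \<open>INF (w, a)\<in>S. p (v + w) + a\<close> meets all of them, since \<open>p 0 = 0\<close>;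
  \<open>nonneg\<close> keeps it finite. It is applied to a ray, for minimal functionals, and to the
  graph of \<open>f\<close>, for the extension.\<close>

lemma sublinear_INF_cone:
  fixes p :: "'a::real_vector \<Rightarrow> real" and S :: "('a \<times> real) set"
  assumes p: "sublinear p"
    and zero: "(0, 0) \<in> S"
    and add: "\<And>w a w' a'. (w, a) \<in> S \<Longrightarrow> (w', a') \<in> S \<Longrightarrow> (w + w', a + a') \<in> S"
    and scale: "\<And>c w a. 0 < c \<Longrightarrow> (w, a) \<in> S \<Longrightarrow> (c *\<^sub>R w, c * a) \<in> S"
    and nonneg: "\<And>w a. (w, a) \<in> S \<Longrightarrow> 0 \<le> p w + a"
  shows "\<exists>q. sublinear q \<and> q \<le> p \<and> (\<forall>w a. (w, a) \<in> S \<longrightarrow> q (- w) \<le> a)"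
proof -
  define q where "q v = (INF (w, a)\<in>S. p (v + w) + a)" for v
  have bdd: "bdd_below ((\<lambda>(w, a). p (v + w) + a) ` S)" for v
  proof (rule bdd_belowI2[where m = "- p (- v)"], clarify)
    fix w a assume "(w, a) \<in> S"
    moreover have "p w \<le> p (v + w) + p (- v)" using sublinear_add[OF p, of "v + w" "- v"] by simp
    ultimately show "- p (- v) \<le> p (v + w) + a" using nonneg by fastforce
  qed
  have lower: "q v \<le> p (v + w) + a" if "(w, a) \<in> S" for v w a
    using cINF_lower[OF bdd that, of v] by (simp add: q_def)
  have greatest: "b \<le> q v" if "\<And>w a. (w, a) \<in> S \<Longrightarrow> b \<le> p (v + w) + a" for b v
    unfolding q_def using zero that by (intro cINF_greatest) auto
  show ?thesis
  proof (intro exI conjI allI impI)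
    show "sublinear q"
    proof (rule sublinearI)
      fix x y
      \<comment> \<open>The two infima are taken one after the other: the pair for \<open>x\<close>
        stays fixed while the one for \<open>y\<close> varies.\<close>
      have "q (x + y) - (p (x + w) + a) \<le> q y" if S: "(w, a) \<in> S" for w a
      proof (rule greatest)
        fix w' a' assume "(w', a') \<in> S"
        then have "q (x + y) \<le> p ((x + y) + (w + w')) + (a + a')" by (intro lower add S)
        also have "(x + y) + (w + w') = (x + w) + (y + w')" by simp
        also have "p \<dots> \<le> p (x + w) + p (y + w')" by (rule sublinear_add[OF p])
        finally show "q (x + y) - (p (x + w) + a) \<le> p (y + w') + a'" by simp
      qed
      then have "q (x + y) - q y \<le> q x" by (intro greatest) (simp add: algebra_simps)
      then show "q (x + y) \<le> q x + q y" by simp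
    next
      fix c :: real and x :: 'a assume c: "0 < c"
      have "inverse c * q (c *\<^sub>R x) \<le> q x"
      proof (rule greatest)
        fix w a assume "(w, a) \<in> S"
        then have "q (c *\<^sub>R x) \<le> p (c *\<^sub>R x + c *\<^sub>R w) + c * a" by (intro lower scale c)
        also have "p (c *\<^sub>R x + c *\<^sub>R w) = c * p (x + w)"
          using sublinear_scaleR[OF p, of c "x + w"] c by (simp add: scaleR_add_right)
        finally show "inverse c * q (c *\<^sub>R x) \<le> p (x + w) + a"
          using c by (simp add: field_simps)
      qed
      then show "q (c *\<^sub>R x) \<le> c * q x" using c by (simp add: field_simps)
    qed
    show "q \<le> p" using lower[OF zero] by (auto simp: le_fun_def)
    show "q (- w) \<le> a" if "(w, a) \<in> S" for w a
      using lower[OF that, of "- w"] sublinear_zero[OF p] by simp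
  qed
qed

text \<open>Zorn's lemma for the reversed pointwise order. The pointwise infimum of a nonempty chain
  is finite, being at least \<open>- p (- v)\<close>, and subadditive, because two members of the
  chain can be replaced by the smaller one.\<close>

lemma ex_minimal_sublinear:
  fixes p :: "'a::real_vector \<Rightarrow> real"
  assumes p: "sublinear p"
  obtains q where "sublinear q" "q \<le> p" "\<And>r. sublinear r \<Longrightarrow> r \<le> q \<Longrightarrow> r = q"
proof -
  define A where "A = {q. sublinear q \<and> q \<le> p}"
  have "\<exists>m\<in>A. \<forall>a\<in>A. a \<le> m \<longrightarrow> a = m"
  proof (rule predicate_Zorn)
    show "partial_order_on A (relation_of (\<lambda>a b. b \<le> a) A)"
      by (rule partial_order_on_relation_ofI) auto
  next
    fix C assume "C \<in> Chains (relation_of (\<lambda>a b. b \<le> a) A)"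
    then have CA: "C \<subseteq> A" and total: "\<And>a b. a \<in> C \<Longrightarrow> b \<in> C \<Longrightarrow> a \<le> b \<or> b \<le> a"
      by (auto simp: Chains_def relation_of_def)
    show "\<exists>u\<in>A. \<forall>a\<in>C. u \<le> a"
    proof (cases "C = {}")
      case True
      then show ?thesis using p by (auto simp: A_def)
    next
      case False
      have sub: "sublinear q" and le: "q v \<le> p v" if "q \<in> C" for q v
        using that CA by (auto simp: A_def le_fun_def)
      define u where "u v = (INF q\<in>C. q v)" for v
      have bdd: "bdd_below ((\<lambda>q. q v) ` C)" for v
      proof (rule bdd_belowI2)
        fix q assume "q \<in> C"
        then show "- p (- v) \<le> q v" using sublinear_minus[OF sub, of q v] le[of q "- v"] by simp
      qed
      have lower: "u v \<le> q v" if "q \<in> C" for q v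
        unfolding u_def by (rule cINF_lower[OF bdd that])
      have greatest: "b \<le> u v" if "\<And>q. q \<in> C \<Longrightarrow> b \<le> q v" for b v
        unfolding u_def by (rule cINF_greatest[OF False that])
      have "sublinear u"
      proof (rule sublinearI)
        fix x y
        have "u (x + y) - q x \<le> u y" if q: "q \<in> C" for q
        proof (rule greatest)
          fix r assume r: "r \<in> C"
          obtain s where s: "s \<in> C" "s \<le> q" "s \<le> r" using total[OF q r] q r by auto
          have "u (x + y) \<le> s x + s y"
            using lower[OF s(1)] sublinear_add[OF sub[OF s(1)]] by (rule order_trans)
          also have "\<dots> \<le> q x + r y" using s by (intro add_mono) (auto simp: le_fun_def)
          finally show "u (x + y) - q x \<le> r y" by simp
        qed
        then have "u (x + y) - u y \<le> u x" by (intro greatest) (simp add: algebra_simps)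
        then show "u (x + y) \<le> u x + u y" by simp
      next
        fix c :: real and x :: 'a assume c: "0 < c"
        have "inverse c * u (c *\<^sub>R x) \<le> u x"
        proof (rule greatest)
          fix q assume q: "q \<in> C"
          show "inverse c * u (c *\<^sub>R x) \<le> q x"
            using lower[OF q, of "c *\<^sub>R x"] sublinear_scaleR[OF sub[OF q], of c x] c
            by (simp add: field_simps)
        qed
        then show "u (c *\<^sub>R x) \<le> c * u x" using c by (simp add: field_simps)
      qed
      moreover have "u \<le> p"
        unfolding le_fun_def using False lower le order_trans by (metis ex_in_conv)
      ultimately show ?thesis using lower by (auto simp: A_def le_fun_def)
    qed
  qed
  then obtain m where m: "m \<in> A" "\<And>a. a \<in> A \<Longrightarrow> a \<le> m \<Longrightarrow> a = m" by blast
  show thesis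
  proof
    show "sublinear m" "m \<le> p" using m(1) by (auto simp: A_def)
    show "r = m" if "sublinear r" "r \<le> m" for r
      using that m by (auto simp: A_def)
  qed
qed

text \<open>A minimal sublinear \<open>q\<close> is odd, hence linear: \<open>v \<mapsto> INF t\<ge>0. q (v + t x) - t q x\<close> is again
  sublinear and below \<open>q\<close>, and its value at \<open>- x\<close> is at most \<open>- q x\<close>.\<close>

lemma ex_linear_le_sublinear:
  fixes p :: "'a::real_vector \<Rightarrow> real"
  assumes p: "sublinear p"
  obtains F where "linear F" "F \<le> p"
proof -
  obtain q where q: "sublinear q" "q \<le> p" and minimal: "\<And>r. sublinear r \<Longrightarrow> r \<le> q \<Longrightarrow> r = q"
    using ex_minimal_sublinear[OF p] by blast
  have odd: "q (- x) = - q x" for x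
  proof -
    let ?S = "{(t *\<^sub>R x, - (t * q x)) | t. 0 \<le> t}"
    have "\<exists>r. sublinear r \<and> r \<le> q \<and> (\<forall>w a. (w, a) \<in> ?S \<longrightarrow> r (- w) \<le> a)"
    proof (rule sublinear_INF_cone[OF q(1), where S = ?S])
      show "(0, 0) \<in> ?S" by (auto intro!: exI[of _ 0])
      show "(w + w', a + a') \<in> ?S" if S: "(w, a) \<in> ?S" "(w', a') \<in> ?S" for w a w' a'
      proof -
        obtain t t' where "w = t *\<^sub>R x" "a = - (t * q x)" "0 \<le> t"
          "w' = t' *\<^sub>R x" "a' = - (t' * q x)" "0 \<le> t'" using S by blast
        then show ?thesis by (auto intro!: exI[of _ "t + t'"] simp: algebra_simps)
      qed
      show "(c *\<^sub>R w, c * a) \<in> ?S" if c: "0 < c" and S: "(w, a) \<in> ?S" for c w a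
      proof -
        obtain t where "w = t *\<^sub>R x" "a = - (t * q x)" "0 \<le> t" using S by blast
        then show ?thesis using c by (auto intro!: exI[of _ "c * t"])
      qed
      \<comment> \<open>Equality holds here, as \<open>q (t *\<^sub>R x) = t * q x\<close>.\<close>
      show "0 \<le> q w + a" if "(w, a) \<in> ?S" for w a
        using that by (auto simp: sublinear_scaleR[OF q(1)])
    qed
    then obtain r where r: "sublinear r" "r \<le> q" "\<And>w a. (w, a) \<in> ?S \<Longrightarrow> r (- w) \<le> a"
      by blast
    have "(x, - q x) \<in> ?S" by (auto intro!: exI[of _ 1])
    with r(3) minimal[OF r(1,2)] have "q (- x) \<le> - q x" by blast
    with sublinear_minus[OF q(1), of x] show ?thesis by simp
  qed
  have "linear q"
  proof (rule linearI)
    fix x y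
    \<comment> \<open>Oddness turns subadditivity at \<open>- x\<close> and \<open>- y\<close> into
      superadditivity at \<open>x\<close> and \<open>y\<close>.\<close>
    have "- q (x + y) \<le> - q x - q y"
      using sublinear_add[OF q(1), of "- x" "- y"] odd[of "x + y"] by (simp add: odd)
    with sublinear_add[OF q(1), of x y] show "q (x + y) = q x + q y" by simp
  next
    fix c :: real and x
    show "q (c *\<^sub>R x) = c *\<^sub>R q x"
      using sublinear_scaleR[OF q(1), of "\<bar>c\<bar>" x] odd[of "c *\<^sub>R x"]
      by (cases "0 \<le> c") auto
  qed
  from this q(2) show thesis by (rule that)
qed

text \<open>Instead of extending \<open>f\<close> one dimension at a time, \<open>p\<close> is
  lowered to a sublinear \<open>q\<close> with \<open>q \<le> f\<close> on \<open>W\<close>. A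
  linear \<open>F\<close> below \<open>q\<close> satisfies \<open>F \<le> f\<close> on
  \<open>W\<close>, and replacing \<open>x\<close> by \<open>- x\<close> gives equality.\<close>

theorem Hahn_Banach_sublinear:
  fixes p f :: "'a::real_vector \<Rightarrow> real"
  assumes p: "sublinear p" and W: "subspace W"
    and add: "\<And>x y. x \<in> W \<Longrightarrow> y \<in> W \<Longrightarrow> f (x + y) = f x + f y"
    and scale: "\<And>c x. x \<in> W \<Longrightarrow> f (c *\<^sub>R x) = c * f x"
    and le: "\<And>x. x \<in> W \<Longrightarrow> f x \<le> p x"
  obtains F where "linear F" "\<And>x. x \<in> W \<Longrightarrow> F x = f x" "F \<le> p"
proof -
  have minus: "f (- x) = - f x" if "x \<in> W" for x
    using scale[OF that, of "- 1"] by simp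
  let ?S = "(\<lambda>w. (- w, f w)) ` W"
  have "\<exists>q. sublinear q \<and> q \<le> p \<and> (\<forall>w a. (w, a) \<in> ?S \<longrightarrow> q (- w) \<le> a)"
  proof (rule sublinear_INF_cone[OF p, where S = ?S])
    show "(0, 0) \<in> ?S"
      using subspace_0[OF W] scale[of 0 0] by (auto intro!: image_eqI[of _ _ 0])
    show "(w + w', a + a') \<in> ?S" if "(w, a) \<in> ?S" "(w', a') \<in> ?S" for w a w' a'
      using that add by (auto intro!: image_eqI[OF _ subspace_add[OF W]])
    show "(c *\<^sub>R w, c * a) \<in> ?S" if "(w, a) \<in> ?S" for c w a
      using that scale by (auto intro!: image_eqI[OF _ subspace_scale[OF W]])
    \<comment> \<open>For \<open>w = - x\<close> and \<open>a = f x\<close> this is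
      \<open>f (- x) \<le> p (- x)\<close>.\<close>
    show "0 \<le> p w + a" if "(w, a) \<in> ?S" for w a
      using that minus le[OF subspace_neg[OF W]] by fastforce
  qed
  then obtain q where q: "sublinear q" "q \<le> p" "\<And>w a. (w, a) \<in> ?S \<Longrightarrow> q (- w) \<le> a"
    by blast
  obtain F where F: "linear F" "F \<le> q" using ex_linear_le_sublinear[OF q(1)] by blast
  have Fle: "F x \<le> f x" if "x \<in> W" for x
  proof -
    have "q x \<le> f x" using q(3)[of "- x" "f x"] that by auto
    with le_funD[OF F(2), of x] show ?thesis by (rule order_trans)
  qed
  show thesis
  proof
    show "linear F" by fact
    show "F \<le> p" using F(2) q(2) by (rule order_trans)
    show "F x = f x" if "x \<in> W" for x
      using Fle[OF that] Fle[OF subspace_neg[OF W that]] minus[OF that] linear_neg[OF F(1), of x]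
      by simp
  qed
qed

section \<open>Norms of functionals on subspaces\<close>

lemma bdd_above_onorm_on:
  assumes "bounded_linear_on W f"
  shows "bdd_above ((\<lambda>x. norm (f x) / norm x) ` W)"
proof -
  obtain K where K: "\<And>x. x \<in> W \<Longrightarrow> norm (f x) \<le> norm x * K"
    using assms unfolding bounded_linear_on_def by blast
  show ?thesis
  proof (rule bdd_aboveI2)
    fix x assume "x \<in> W"
    then have "norm (f x) \<le> norm x * K" by (rule K)
    \<comment> \<open>The constant \<open>K\<close> may be negative when \<open>W = {0}\<close>,
      whereas the quotient at \<open>0\<close> is \<open>0\<close>.\<close>
    also have "\<dots> \<le> norm x * max 0 K" by (intro mult_left_mono) auto
    finally show "norm (f x) / norm x \<le> max 0 K"
      by (cases "x = 0") (auto simp: field_simps)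
  qed
qed

lemma onorm_on_upper:
  assumes f: "bounded_linear_on W f" and x: "x \<in> W"
  shows "norm (f x) \<le> onorm_on W f * norm x"
proof (cases "x = 0")
  case True
  have "f (0 *\<^sub>R x) = 0 *\<^sub>R f x" using f x unfolding bounded_linear_on_def by blast
  with True show ?thesis by simp
next
  case False
  have "norm (f x) / norm x \<le> onorm_on W f"
    unfolding onorm_on_def by (rule cSUP_upper[OF x bdd_above_onorm_on[OF f]])
  then show ?thesis using False by (simp add: field_simps)
qed

lemma onorm_on_nonneg:
  assumes f: "bounded_linear_on W f" and "x \<in> W"
  shows "0 \<le> onorm_on W f"
  unfolding onorm_on_def
  by (rule cSUP_upper2[OF bdd_above_onorm_on[OF f] assms(2)]) simp

section \<open>Positive functionals on order smooth spaces\<close>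

lemma order_smooth_inf_on_subspace: "order_smooth_inf_on W \<Longrightarrow> subspace W"
  by (simp add: order_smooth_inf_on_def)

lemma order_smooth_inf_on_norm_le:
  "order_smooth_inf_on W \<Longrightarrow> u \<in> W \<Longrightarrow> v \<in> W \<Longrightarrow> w \<in> W \<Longrightarrow> u \<le> v \<Longrightarrow> v \<le> w
    \<Longrightarrow> norm v \<le> max (norm u) (norm w)"
  unfolding order_smooth_inf_on_def by blast

lemma order_smooth_inf_on_decompose:
  assumes "order_smooth_inf_on W" "v \<in> W" "0 < \<epsilon>"
  obtains v1 v2 where "v1 \<in> W" "0 \<le> v1" "v2 \<in> W" "0 \<le> v2" "v = v1 - v2"
    "norm v1 \<le> norm v + \<epsilon>" "norm v2 \<le> norm v + \<epsilon>"
proof -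
  have "\<exists>v1\<in>pos_cone W. \<exists>v2\<in>pos_cone W. v = v1 - v2 \<and> max (norm v1) (norm v2) \<le> norm v + \<epsilon>"
    using assms unfolding order_smooth_inf_on_def by blast
  then show thesis using that unfolding pos_cone_def by auto
qed

text \<open>Positive vectors suffice to compute the norm: for \<open>v = v1 - v2\<close> with
  positive parts, \<open>f v1\<close> and \<open>f v2\<close> are nonnegative, so their difference
  is at most their maximum in absolute value. The parts are hardly longer than
  \<open>v\<close>.\<close>

lemma onorm_on_almost_attained:
  fixes f :: "'a::{real_normed_vector, ordered_real_vector} \<Rightarrow> real"
  assumes W: "order_smooth_inf_on W" and f: "bounded_linear_on W f"
    and pos: "\<And>w. w \<in> W \<Longrightarrow> 0 \<le> w \<Longrightarrow> 0 \<le> f w"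
    and \<epsilon>: "0 < \<epsilon>"
  obtains w where "w \<in> W" "0 \<le> w" "norm w \<le> 1" "onorm_on W f - \<epsilon> \<le> f w"
proof -
  note sub = order_smooth_inf_on_subspace[OF W]
  have f_add: "f (x + y) = f x + f y" if "x \<in> W" "y \<in> W" for x y
    using f that by (auto simp: bounded_linear_on_def)
  have f_scale: "f (c *\<^sub>R x) = c * f x" if "x \<in> W" for c x
    using f that by (auto simp: bounded_linear_on_def)
  define K where "K = onorm_on W f"
  show thesis
  proof (cases "K \<le> \<epsilon>")
    case True
    then show thesis
      using that[of 0] subspace_0[OF sub] pos[of 0] by (auto simp: K_def)
  next
    case False
    text \<open>Near-maximality on \<open>W\<close> gives \<open>v\<close> with \<open>\<bar>f v\<bar> > (K - \<epsilon>) norm v\<close>, and the slack is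
      used up when \<open>v\<close> is replaced by a positive part of slightly larger norm.\<close>
    have "W \<noteq> {}" using subspace_0[OF sub] by blast
    moreover have "K - \<epsilon> < (SUP x\<in>W. norm (f x) / norm x)" using \<epsilon> by (simp add: K_def onorm_on_def)
    ultimately obtain v where v: "v \<in> W" "K - \<epsilon> < norm (f v) / norm v"
      using less_cSUP_iff[OF _ bdd_above_onorm_on[OF f]] by blast
    have v0: "0 < norm v" using v False by (cases "v = 0") auto
    have fv: "(K - \<epsilon>) * norm v < \<bar>f v\<bar>" using v(2) v0 by (simp add: field_simps)
    define \<delta> where "\<delta> = \<bar>f v\<bar> / (K - \<epsilon>) - norm v"
    have \<delta>: "0 < \<delta>" using fv False by (simp add: \<delta>_def field_simps)
    obtain v1 v2 where dec: "v1 \<in> W" "0 \<le> v1" "v2 \<in> W" "0 \<le> v2" "v = v1 - v2"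
      "norm v1 \<le> norm v + \<delta>" "norm v2 \<le> norm v + \<delta>"
      using order_smooth_inf_on_decompose[OF W v(1) \<delta>] by blast
    have "f v = f v1 - f v2"
      using f_add[OF v(1) dec(3)] dec(5) by simp
    then have "\<bar>f v\<bar> \<le> max (f v1) (f v2)"
      using pos[OF dec(1,2)] pos[OF dec(3,4)] by linarith
    then obtain u where u: "u \<in> W" "0 \<le> u" "norm u \<le> norm v + \<delta>" "\<bar>f v\<bar> \<le> f u"
      using dec by (auto simp: max_def split: if_splits)
    \<comment> \<open>By the choice of \<open>\<delta>\<close>, dividing \<open>u\<close> by
      \<open>N\<close> makes its norm at most \<open>1\<close> and its value at least
      \<open>K - \<epsilon>\<close>.\<close>
    define N where "N = norm v + \<delta>"
    have N: "0 < N" "(K - \<epsilon>) * N = \<bar>f v\<bar>"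
      using add_pos_pos[OF v0 \<delta>] False by (simp_all add: N_def \<delta>_def)
    show thesis
    proof (rule that)
      show "inverse N *\<^sub>R u \<in> W" using u(1) by (rule subspace_scale[OF sub])
      show "0 \<le> inverse N *\<^sub>R u" using u(2) N(1) by (simp add: scaleR_nonneg_nonneg)
      show "norm (inverse N *\<^sub>R u) \<le> 1" using u(3) N(1) unfolding N_def[symmetric] by (simp add: field_simps)
      have "(K - \<epsilon>) * N \<le> f u" using N(2) u(4) by simp
      then show "onorm_on W f - \<epsilon> \<le> f (inverse N *\<^sub>R u)"
        using N(1) by (simp add: f_scale[OF u(1)] K_def[symmetric] field_simps)
    qed
  qed
qed

lemma positive_functional_le_onorm_on:
  fixes f :: "'a::{real_normed_vector, ordered_real_vector} \<Rightarrow> real"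
  assumes V: "order_smooth_inf_on (UNIV :: 'a set)" and W: "order_smooth_inf_on W"
    and f: "bounded_linear_on W f"
    and pos: "\<And>w. w \<in> W \<Longrightarrow> 0 \<le> w \<Longrightarrow> 0 \<le> f w"
    and w: "w \<in> W" and le: "w \<le> u"
  shows "f w \<le> onorm_on W f * norm u"
proof (rule field_le_epsilon)
  fix e :: real assume e: "0 < e"
  note sub = order_smooth_inf_on_subspace[OF W]
  define K where "K = onorm_on W f"
  \<comment> \<open>This bounds the norm of the negative part \<open>w2\<close> chosen below. The
    error \<open>e / t\<close> in the choice of \<open>w0\<close> becomes \<open>e\<close> after
    multiplication by \<open>t\<close>.\<close>
  define t where "t = norm w + 1"
  have t: "0 < t" by (simp add: t_def add_nonneg_pos)
  obtain w0 where w0: "w0 \<in> W" "0 \<le> w0" "norm w0 \<le> 1" "K - e / t \<le> f w0"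
    using onorm_on_almost_attained[OF W f pos, of "e / t"] e t unfolding K_def by auto
  obtain w1 w2 where dec: "w1 \<in> W" "0 \<le> w1" "w2 \<in> W" "0 \<le> w2" "w = w1 - w2"
    "norm w1 \<le> norm w + 1" "norm w2 \<le> norm w + 1"
    by (rule order_smooth_inf_on_decompose[OF W w zero_less_one])
  define x where "x = w + t *\<^sub>R w0"
  have x: "x \<in> W" unfolding x_def by (intro subspace_add subspace_scale sub w w0)
  have tw0: "0 \<le> t *\<^sub>R w0" using t w0(2) by (simp add: scaleR_nonneg_nonneg)
  \<comment> \<open>The order interval is taken in the whole space, as \<open>u\<close> may lie
    outside \<open>W\<close>; only \<open>x\<close> has to be in \<open>W\<close> for
    \<open>f\<close> to be bounded there.\<close>
  have "norm x \<le> max (norm (- w2)) (norm (u + t *\<^sub>R w0))"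
  proof (rule order_smooth_inf_on_norm_le[OF V])
    have "- w2 \<le> w" using dec(2,5) by simp
    also have "w \<le> x" unfolding x_def using tw0 by simp
    finally show "- w2 \<le> x" .
    show "x \<le> u + t *\<^sub>R w0" unfolding x_def using le by simp
  qed auto
  also have "norm (u + t *\<^sub>R w0) \<le> norm u + t * norm w0"
    using norm_triangle_ineq[of u "t *\<^sub>R w0"] t by simp
  also have "t * norm w0 \<le> t" using mult_left_mono[OF w0(3), of t] t by simp
  finally have "norm x \<le> max (norm (- w2)) (norm u + t)" by simp
  then have nx: "norm x \<le> norm u + t" 
    using dec(7) norm_ge_zero[of u] unfolding t_def norm_minus_cancel by linarith
  have "0 \<le> K" unfolding K_def by (rule onorm_on_nonneg[OF f w])
  have "f w + t * f w0 = f x"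
    using f w w0(1) subspace_scale[OF sub w0(1), of t] unfolding x_def bounded_linear_on_def by simp
  also have "\<dots> \<le> K * norm x"
    using onorm_on_upper[OF f x] by (simp add: K_def)
  also have "\<dots> \<le> K * (norm u + t)" using nx \<open>0 \<le> K\<close> by (rule mult_left_mono)
  finally have "f w + t * f w0 \<le> K * norm u + K * t" by (simp add: algebra_simps)
  moreover have "t * K - e \<le> t * f w0"
    using mult_left_mono[OF w0(4), of t] t by (simp add: algebra_simps)
  ultimately show "f w \<le> onorm_on W f * norm u + e"
    by (simp add: K_def algebra_simps)
qed

section \<open>The half-norm given by positive upper bounds, and the extension\<close>

definition upper_norm :: "'a::{real_normed_vector, ordered_real_vector} \<Rightarrow> real" where
  "upper_norm v = (INF u\<in>{u. 0 \<le> u \<and> v \<le> u}. norm u)"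

lemma upper_norm_le: "0 \<le> u \<Longrightarrow> v \<le> u \<Longrightarrow> upper_norm v \<le> norm u"
  unfolding upper_norm_def by (rule cINF_lower) (auto intro: bdd_belowI2[where m = 0])

text \<open>An infimum over the empty set would say nothing; the positive part \<open>v1\<close> of
  a decomposition of \<open>v\<close> is an admissible upper bound.\<close>

lemma le_upper_norm:
  assumes V: "order_smooth_inf_on (UNIV :: 'a::{real_normed_vector, ordered_real_vector} set)"
    and "\<And>u. 0 \<le> u \<Longrightarrow> v \<le> u \<Longrightarrow> b \<le> norm u"
  shows "b \<le> upper_norm (v :: 'a)"
proof -
  obtain v1 v2 where "0 \<le> v1" "0 \<le> v2" "v = v1 - v2"
    by (rule order_smooth_inf_on_decompose[OF V UNIV_I zero_less_one])
  then have "v1 \<in> {u. 0 \<le> u \<and> v \<le> u}" by simp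
  then show ?thesis unfolding upper_norm_def using assms(2) by (intro cINF_greatest) auto
qed

lemma upper_norm_le_norm:
  assumes V: "order_smooth_inf_on (UNIV :: 'a::{real_normed_vector, ordered_real_vector} set)"
  shows "upper_norm (v :: 'a) \<le> norm v"
proof (rule field_le_epsilon)
  fix e :: real assume e: "0 < e"
  obtain v1 v2 where "0 \<le> v1" "0 \<le> v2" "v = v1 - v2" "norm v1 \<le> norm v + e"
    by (rule order_smooth_inf_on_decompose[OF V UNIV_I e])
  then show "upper_norm v \<le> norm v + e" using upper_norm_le[of v1 v] by simp
qed

text \<open>Sums and positive multiples of positive upper bounds are again positive upper bounds,
  and the norm is itself sublinear.\<close>

lemma sublinear_upper_norm:
  assumes V: "order_smooth_inf_on (UNIV :: 'a::{real_normed_vector, ordered_real_vector} set)"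
  shows "sublinear (upper_norm :: 'a \<Rightarrow> real)"
proof (rule sublinearI)
  fix x y :: 'a
  have "upper_norm (x + y) - norm u \<le> upper_norm y" if u: "0 \<le> u" "x \<le> u" for u
  proof (rule le_upper_norm[OF V])
    fix u' assume "0 \<le> u'" "y \<le> u'"
    then have "upper_norm (x + y) \<le> norm (u + u')"
      using u by (intro upper_norm_le add_nonneg_nonneg add_mono)
    then show "upper_norm (x + y) - norm u \<le> norm u'" using norm_triangle_ineq[of u u'] by simp
  qed
  then have "upper_norm (x + y) - upper_norm y \<le> upper_norm x"
    by (intro le_upper_norm[OF V]) (simp add: algebra_simps)
  then show "upper_norm (x + y) \<le> upper_norm x + upper_norm y" by simp
next
  fix c :: real and x :: 'a assume c: "0 < c"
  have "inverse c * upper_norm (c *\<^sub>R x) \<le> upper_norm x"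
  proof (rule le_upper_norm[OF V])
    fix u assume "0 \<le> u" "x \<le> u"
    then have "upper_norm (c *\<^sub>R x) \<le> norm (c *\<^sub>R u)"
      using c by (intro upper_norm_le scaleR_nonneg_nonneg scaleR_left_mono) auto
    then show "inverse c * upper_norm (c *\<^sub>R x) \<le> norm u" using c by (simp add: field_simps)
  qed
  then show "upper_norm (c *\<^sub>R x) \<le> c * upper_norm x" using c by (simp add: field_simps)
qed

theorem theorem2p5:
  fixes W :: "'a::{real_normed_vector, ordered_real_vector} set"
    and f :: "'a \<Rightarrow> real"
  assumes "order_smooth_inf_on (UNIV :: 'a set)"
    and "order_smooth_inf_on W"
    and "bounded_linear_on W f"
    and "\<forall>w\<in>pos_cone W. 0 \<le> f w"
  shows "\<exists>F :: 'a \<Rightarrow> real. bounded_linear F \<and> (\<forall>v\<in>pos_cone UNIV. 0 \<le> F v) \<and>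
           (\<forall>w\<in>W. F w = f w) \<and> onorm F = onorm_on W f"
proof -
  note V = assms(1) and W = assms(2) and f = assms(3)
  have pos: "0 \<le> f w" if "w \<in> W" "0 \<le> w" for w
    using assms(4) that by (simp add: pos_cone_def)
  note sub = order_smooth_inf_on_subspace[OF W]
  define K where "K = onorm_on W f"
  have K: "0 \<le> K" unfolding K_def by (rule onorm_on_nonneg[OF f subspace_0[OF sub]])
  have upper: "sublinear (upper_norm :: 'a \<Rightarrow> real)" by (rule sublinear_upper_norm[OF V])
  have p: "sublinear (\<lambda>v :: 'a. K * upper_norm v)"
  proof (rule sublinearI)
    fix x y :: 'a
    show "K * upper_norm (x + y) \<le> K * upper_norm x + K * upper_norm y"
      using mult_left_mono[OF sublinear_add[OF upper] K, of x y] by (simp add: algebra_simps)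
  qed (simp add: sublinear_scaleR[OF upper])
  have f_le: "f w \<le> K * upper_norm w" if "w \<in> W" for w
  \<comment> \<open>For \<open>K > 0\<close> the bound \<open>f w \<le> K * norm u\<close> is
    divided by \<open>K\<close> before passing to the infimum over \<open>u\<close>; for
    \<open>K = 0\<close> the functional vanishes on \<open>W\<close>.\<close>
  proof (cases "K = 0")
    case True
    then show ?thesis using onorm_on_upper[OF f that] by (simp add: K_def)
  next
    case False
    then have "f w / K \<le> upper_norm w"
      using positive_functional_le_onorm_on[OF V W f pos that] K
      by (intro le_upper_norm[OF V]) (auto simp: K_def[symmetric] field_simps)
    then show ?thesis using False K by (simp add: field_simps)
  qed
  obtain F where F: "linear F" "\<And>w. w \<in> W \<Longrightarrow> F w = f w" "F \<le> (\<lambda>v. K * upper_norm v)"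
    using Hahn_Banach_sublinear[OF p sub _ _ f_le] f
    unfolding bounded_linear_on_def real_scaleR_def by metis
  have F_le: "F v \<le> K * upper_norm v" for v using F(3) by (simp add: le_fun_def)
  have F_bound: "norm (F v) \<le> K * norm v" for v
  proof -
    have *: "F x \<le> K * norm x" for x
      using F_le mult_left_mono[OF upper_norm_le_norm[OF V] K] by (rule order_trans)
    show ?thesis using *[of v] *[of "- v"] linear_neg[OF F(1), of v] by simp
  qed
  have bl: "bounded_linear F"
    using F(1) F_bound
    by (auto simp: bounded_linear_def bounded_linear_axioms_def mult.commute intro!: exI[of _ K])
  have "0 \<le> F v" if "v \<in> pos_cone UNIV" for v
  proof -
    \<comment> \<open>The vector \<open>0\<close> is an admissible upper bound of
      \<open>- v\<close>.\<close>
    have "upper_norm (- v) \<le> 0" using upper_norm_le[of 0 "- v"] that by (simp add: pos_cone_def)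
    then have "F (- v) \<le> 0" using F_le[of "- v"] K by (meson mult_nonneg_nonpos order_trans)
    then show ?thesis using linear_neg[OF F(1), of v] by simp
  qed
  moreover have "onorm F = onorm_on W f"
  proof (rule antisym)
    show "onorm F \<le> onorm_on W f" using onorm_bound[OF K F_bound] by (simp add: K_def)
    \<comment> \<open>An extension cannot have smaller norm: each quotient of \<open>f\<close> on
      \<open>W\<close> is also one of \<open>F\<close>.\<close>
    have "norm (f w) / norm w \<le> onorm F" if "w \<in> W" for w
      using le_onorm[OF bl, of w] F(2)[OF that] by simp
    then show "onorm_on W f \<le> onorm F"
      unfolding onorm_on_def using subspace_0[OF sub] by (intro cSUP_least) auto
  qed
  ultimately show ?thesis using bl F(2) by blast
qed

end
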